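(* Let $p$ be an odd prime and $a\in\mathbf{F}_p$. Then $h_p(\langle 1,a\rangle)=(p+1)/2$ if and only if $a=(p-1)/2+p\mathbf{Z}$ or $a=p-2+p\mathbf{Z}$. Moreover, if $a\notin\{(p-1)/2+p\mathbf{Z},\ p-2+p\mathbf{Z},\ p-1+p\mathbf{Z}\}$, then $h_p(\langle 1,a\rangle)\le \frac{p-1}{2}$.
   Context: $\mathbf{F}_p=\mathbf{Z}/p\mathbf{Z}$. $\mathbf{P}^{1}(\mathbf{F}_p)$ is the set of equivalence classes $\langle a_1,a_2\rangle$ of nonzero pairs in $\mathbf{F}_p^2$ under $(a_1,a_2)\sim(ka_1,ka_2)$ for $k\in\mathbf{F}_p\setminus\{0\}$. For $x\in\mathbf{F}_p$, $x \bmod p$ denotes the least nonnegative integer in the class $x$. The height of $\langle a_1,a_2\rangle$ is $h_p(\langle a_1,a_2\rangle)=\min\{(ka_1\bmod p)+(ka_2 \bmod p): k=1,\ldots,p-1\}$; in particular $h_p(\langle 1,a\rangle)=\min\{k+(ka\bmod p):k=1,\ldots,p-1\}$. *)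

theory Defs
  imports "HOL-Algebra.IntRing" "HOL-Number_Theory.Cong"
begin

text \<open>
  The field with p elements is the quotient ring \<^term>\<open>ZFact (int p)\<close>; its elements are literally the
  cosets \<^term>\<open>ZMod (int p) n\<close>, that is, n + pZ.
\<close>

abbreviation Fp :: "nat \<Rightarrow> int set ring"
  where "Fp p \<equiv> ZFact (int p)"

abbreviation residue_class :: "nat \<Rightarrow> int \<Rightarrow> int set"
  where "residue_class p n \<equiv> ZMod (int p) n"

definition least_residue :: "int set \<Rightarrow> nat"
  where "least_residue x = (LEAST n. int n \<in> x)"

definition nonzero_pairs :: "nat \<Rightarrow> (int set \<times> int set) set"
  where "nonzero_pairs p =
    carrier (Fp p) \<times> carrier (Fp p) - {(\<zero>\<^bsub>Fp p\<^esub>, \<zero>\<^bsub>Fp p\<^esub>)}"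

definition proj_rel :: "nat \<Rightarrow> ((int set \<times> int set) \<times> (int set \<times> int set)) set"
  where "proj_rel p =
    {(u, v). u \<in> nonzero_pairs p \<and>
       (\<exists>k \<in> carrier (Fp p) - {\<zero>\<^bsub>Fp p\<^esub>}.
          v = (k \<otimes>\<^bsub>Fp p\<^esub> fst u, k \<otimes>\<^bsub>Fp p\<^esub> snd u))}"

definition proj_line :: "nat \<Rightarrow> (int set \<times> int set) set set"
  where "proj_line p = nonzero_pairs p // proj_rel p"

definition proj_point :: "nat \<Rightarrow> int set \<Rightarrow> int set \<Rightarrow> (int set \<times> int set) set"
  where "proj_point p a1 a2 = proj_rel p `` {(a1, a2)}"

definition pair_height :: "nat \<Rightarrow> int set \<times> int set \<Rightarrow> nat"
  where "pair_height p u =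
    Min ((\<lambda>k. least_residue (residue_class p (int k) \<otimes>\<^bsub>Fp p\<^esub> fst u)
             + least_residue (residue_class p (int k) \<otimes>\<^bsub>Fp p\<^esub> snd u)) ` {1..p - 1})"

text \<open>
  The height of a point is the common value of \<^term>\<open>pair_height p\<close> on its representatives; that
  this is well defined for prime p is \<open>height_proj_point\<close> below.
\<close>

definition height :: "nat \<Rightarrow> (int set \<times> int set) set \<Rightarrow> nat"
  where "height p P = (THE h. \<forall>u \<in> P. h = pair_height p u)"


lemma residue_class_eq: "residue_class p n = {m. m mod int p = n mod int p}"
proof -
  have "residue_class p n = {m. \<exists>x. m = x * int p + n}"
    by (auto simp: ZMod_def int_Idl a_r_coset_defs)
  also have "\<dots> = {m. m mod int p = n mod int p}"
  proof (intro Collect_cong iffI)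
    fix m assume "m mod int p = n mod int p"
    then have "int p dvd m - n" by (simp add: mod_eq_dvd_iff)
    then obtain x where "m - n = int p * x" by (auto elim: dvdE)
    then show "\<exists>x. m = x * int p + n" by (intro exI[of _ x]) (simp add: algebra_simps)
  qed auto
  finally show ?thesis .
qed

lemma least_residue_residue_class:
  assumes "p > 0"
  shows "least_residue (residue_class p n) = nat (n mod int p)"
  unfolding least_residue_def residue_class_eq
proof (rule Least_equality)
  show "int (nat (n mod int p)) \<in> {m. m mod int p = n mod int p}"
    using assms by simp
next
  fix y assume "int y \<in> {m. m mod int p = n mod int p}"
  then have "n mod int p = int (y mod p)" by (simp add: of_nat_mod)
  then show "nat (n mod int p) \<le> y" by simp
qed

lemma carrier_Fp: "carrier (Fp p) = range (residue_class p)"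
  by (auto simp: ZFact_def FactRing_def A_RCOSETS_defs ZMod_def a_r_coset_defs)

lemma zero_Fp: "\<zero>\<^bsub>Fp p\<^esub> = residue_class p 0"
proof -
  interpret ideal "Idl\<^bsub>\<Z>\<^esub> {int p}" \<Z>
    by (rule int.genideal_ideal) simp
  show ?thesis
    by (simp add: ZFact_def FactRing_def ZMod_def a_r_coset_defs)
qed

lemma one_Fp: "\<one>\<^bsub>Fp p\<^esub> = residue_class p 1"
  by (simp add: ZFact_def FactRing_def ZMod_def)

lemma mult_Fp:
  "residue_class p m \<otimes>\<^bsub>Fp p\<^esub> residue_class p n = residue_class p (m * n)"
proof -
  interpret ideal "Idl\<^bsub>\<Z>\<^esub> {int p}" \<Z>
    by (rule int.genideal_ideal) simp
  show ?thesis
    using rcoset_mult_add[of m n] by (simp add: ZFact_def FactRing_def ZMod_def)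
qed

lemma ex_inverse_Fp:
  assumes "Factorial_Ring.prime p" "c \<in> carrier (Fp p) - {\<zero>\<^bsub>Fp p\<^esub>}"
  shows "\<exists>d \<in> carrier (Fp p) - {\<zero>\<^bsub>Fp p\<^esub>}. d \<otimes>\<^bsub>Fp p\<^esub> c = \<one>\<^bsub>Fp p\<^esub>"
proof -
  from assms(2) obtain n where n: "c = residue_class p n" by (auto simp: carrier_Fp)
  have "n mod int p \<noteq> 0" using assms(2) n by (auto simp: zero_Fp ZMod_eq_mod)
  then have "\<not> int p dvd n" by auto
  then have "coprime n (int p)"
    using assms(1) by (metis prime_imp_coprime coprime_commute prime_nat_int_transfer)
  then obtain m where m: "[n * m = 1] (mod int p)"
    using cong_solve_coprime_int by blast
  have "residue_class p m \<noteq> \<zero>\<^bsub>Fp p\<^esub>"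
  proof
    assume "residue_class p m = \<zero>\<^bsub>Fp p\<^esub>"
    then have "int p dvd m" by (auto simp: zero_Fp ZMod_eq_mod)
    then have "int p dvd n * m" by simp
    then have "int p dvd 1" using m by (metis cong_dvd_iff)
    then show False using assms(1) by (auto dest: not_prime_unit)
  qed
  moreover have "residue_class p m \<otimes>\<^bsub>Fp p\<^esub> c = \<one>\<^bsub>Fp p\<^esub>"
    using m by (simp add: n mult_Fp one_Fp ZMod_eq_mod cong_def mult.commute)
  ultimately show ?thesis by (auto simp: carrier_Fp)
qed

lemma units_Fp:
  assumes "p > 0"
  shows "(\<lambda>k. residue_class p (int k)) ` {1..p - 1} = carrier (Fp p) - {\<zero>\<^bsub>Fp p\<^esub>}"
proof (intro equalityI subsetI)
  fix x assume "x \<in> (\<lambda>k. residue_class p (int k)) ` {1..p - 1}"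
  then obtain k where "x = residue_class p (int k)" "1 \<le> k" "k < p" using assms by auto
  then show "x \<in> carrier (Fp p) - {\<zero>\<^bsub>Fp p\<^esub>}"
    by (auto simp: carrier_Fp zero_Fp ZMod_eq_mod)
next
  fix x assume x: "x \<in> carrier (Fp p) - {\<zero>\<^bsub>Fp p\<^esub>}"
  then obtain n where n: "x = residue_class p n" by (auto simp: carrier_Fp)
  define k where "k = nat (n mod int p)"
  have k: "int k = n mod int p" using assms by (simp add: k_def)
  have "x = residue_class p (int k)" by (simp add: n k ZMod_eq_mod)
  moreover have "int k \<noteq> 0" using x n k by (auto simp: zero_Fp ZMod_eq_mod)
  moreover have "int k < int p" using assms k by simp
  ultimately show "x \<in> (\<lambda>k. residue_class p (int k)) ` {1..p - 1}" by auto
qed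

lemma pair_height_units:
  assumes "p > 0"
  shows "pair_height p u =
    Min ((\<lambda>c. least_residue (c \<otimes>\<^bsub>Fp p\<^esub> fst u) + least_residue (c \<otimes>\<^bsub>Fp p\<^esub> snd u))
          ` (carrier (Fp p) - {\<zero>\<^bsub>Fp p\<^esub>}))"
  unfolding pair_height_def units_Fp[OF assms, symmetric] image_image ..

lemma units_mult_Fp:
  assumes "Factorial_Ring.prime p"
    and "c \<in> carrier (Fp p) - {\<zero>\<^bsub>Fp p\<^esub>}" "d \<in> carrier (Fp p) - {\<zero>\<^bsub>Fp p\<^esub>}"
  shows "c \<otimes>\<^bsub>Fp p\<^esub> d \<in> carrier (Fp p) - {\<zero>\<^bsub>Fp p\<^esub>}"
proof -
  interpret domain "Fp p" by (rule ZFact_prime_is_domain) (use assms in simp)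
  show ?thesis using assms(2,3) by (simp add: integral_iff)
qed

lemma proj_rel_carrier:
  assumes "Factorial_Ring.prime p" "(u, v) \<in> proj_rel p"
  shows "v \<in> nonzero_pairs p"
proof -
  interpret domain "Fp p" by (rule ZFact_prime_is_domain) (use assms in simp)
  show ?thesis
    using assms unfolding proj_rel_def nonzero_pairs_def
    by (clarsimp simp: integral_iff)
qed

lemma equiv_proj_rel:
  assumes p: "Factorial_Ring.prime p"
  shows "equiv (nonzero_pairs p) (proj_rel p)"
proof -
  interpret domain "Fp p" by (rule ZFact_prime_is_domain) (use p in simp)
  show ?thesis
  proof (rule equivI)
    show "proj_rel p \<subseteq> nonzero_pairs p \<times> nonzero_pairs p"
    proof (rule subrelI)
      fix u v assume uv: "(u, v) \<in> proj_rel p"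
      then have "u \<in> nonzero_pairs p" unfolding proj_rel_def by blast
      with proj_rel_carrier[OF p uv] show "(u, v) \<in> nonzero_pairs p \<times> nonzero_pairs p" by blast
    qed
    show "refl_on (nonzero_pairs p) (proj_rel p)"
      unfolding refl_on_def proj_rel_def
      by (intro ballI CollectI case_prodI conjI bexI[of _ "\<one>\<^bsub>Fp p\<^esub>"])
         (simp_all add: nonzero_pairs_def mem_Times_iff)
    show "sym (proj_rel p)"
    proof (rule symI)
      fix u v assume uv: "(u, v) \<in> proj_rel p"
      then obtain k where k: "k \<in> carrier (Fp p) - {\<zero>\<^bsub>Fp p\<^esub>}"
        "v = (k \<otimes>\<^bsub>Fp p\<^esub> fst u, k \<otimes>\<^bsub>Fp p\<^esub> snd u)" "u \<in> nonzero_pairs p"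
        unfolding proj_rel_def by blast
      obtain d where d: "d \<in> carrier (Fp p) - {\<zero>\<^bsub>Fp p\<^esub>}" "d \<otimes>\<^bsub>Fp p\<^esub> k = \<one>\<^bsub>Fp p\<^esub>"
        using ex_inverse_Fp[OF p k(1)] by blast
      have "u = (d \<otimes>\<^bsub>Fp p\<^esub> fst v, d \<otimes>\<^bsub>Fp p\<^esub> snd v)"
        using k d by (simp add: nonzero_pairs_def mem_Times_iff m_assoc[symmetric])
      then show "(v, u) \<in> proj_rel p"
        using d(1) proj_rel_carrier[OF p uv] unfolding proj_rel_def by blast
    qed
    show "trans (proj_rel p)"
    proof (rule transI)
      fix u v w assume uv: "(u, v) \<in> proj_rel p" and vw: "(v, w) \<in> proj_rel p"
      from uv obtain k where k: "k \<in> carrier (Fp p) - {\<zero>\<^bsub>Fp p\<^esub>}"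
        "v = (k \<otimes>\<^bsub>Fp p\<^esub> fst u, k \<otimes>\<^bsub>Fp p\<^esub> snd u)" "u \<in> nonzero_pairs p"
        unfolding proj_rel_def by blast
      from vw obtain l where l: "l \<in> carrier (Fp p) - {\<zero>\<^bsub>Fp p\<^esub>}"
        "w = (l \<otimes>\<^bsub>Fp p\<^esub> fst v, l \<otimes>\<^bsub>Fp p\<^esub> snd v)"
        unfolding proj_rel_def by blast
      have "w = ((l \<otimes>\<^bsub>Fp p\<^esub> k) \<otimes>\<^bsub>Fp p\<^esub> fst u, (l \<otimes>\<^bsub>Fp p\<^esub> k) \<otimes>\<^bsub>Fp p\<^esub> snd u)"
        using k l by (simp add: nonzero_pairs_def mem_Times_iff m_assoc)
      moreover have "l \<otimes>\<^bsub>Fp p\<^esub> k \<in> carrier (Fp p) - {\<zero>\<^bsub>Fp p\<^esub>}"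
        by (rule units_mult_Fp[OF p l(1) k(1)])
      ultimately show "(u, w) \<in> proj_rel p" using k(3) unfolding proj_rel_def by blast
    qed
  qed
qed

lemma pair_height_cong:
  assumes p: "Factorial_Ring.prime p" and uv: "(u, v) \<in> proj_rel p"
  shows "pair_height p u = pair_height p v"
proof -
  interpret domain "Fp p" by (rule ZFact_prime_is_domain) (use p in simp)
  let ?U = "carrier (Fp p) - {\<zero>\<^bsub>Fp p\<^esub>}"
  have p0: "p > 0" using p by (simp add: prime_gt_0_nat)
  from uv obtain k where k: "k \<in> ?U"
    "v = (k \<otimes>\<^bsub>Fp p\<^esub> fst u, k \<otimes>\<^bsub>Fp p\<^esub> snd u)" "u \<in> nonzero_pairs p"
    unfolding proj_rel_def by blast
  obtain d where d: "d \<in> ?U" "d \<otimes>\<^bsub>Fp p\<^esub> k = \<one>\<^bsub>Fp p\<^esub>"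
    using ex_inverse_Fp[OF p k(1)] by blast
  have U: "(\<lambda>c. c \<otimes>\<^bsub>Fp p\<^esub> k) ` ?U = ?U"
  proof (intro equalityI subsetI)
    fix x assume x: "x \<in> ?U"
    have "x = (x \<otimes>\<^bsub>Fp p\<^esub> d) \<otimes>\<^bsub>Fp p\<^esub> k"
      using k(1) d x by (simp add: m_assoc)
    then show "x \<in> (\<lambda>c. c \<otimes>\<^bsub>Fp p\<^esub> k) ` ?U"
      using units_mult_Fp[OF p x d(1)] by (rule image_eqI)
  next
    fix x assume "x \<in> (\<lambda>c. c \<otimes>\<^bsub>Fp p\<^esub> k) ` ?U"
    then show "x \<in> ?U" using units_mult_Fp[OF p _ k(1)] by blast
  qed
  let ?f = "\<lambda>c. least_residue (c \<otimes>\<^bsub>Fp p\<^esub> fst u) + least_residue (c \<otimes>\<^bsub>Fp p\<^esub> snd u)"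
  have "pair_height p v = Min ((\<lambda>c. ?f (c \<otimes>\<^bsub>Fp p\<^esub> k)) ` ?U)"
    unfolding pair_height_units[OF p0]
    by (intro arg_cong[where f = Min] image_cong refl)
       (use k in \<open>simp add: nonzero_pairs_def mem_Times_iff m_assoc\<close>)
  also have "\<dots> = Min (?f ` ((\<lambda>c. c \<otimes>\<^bsub>Fp p\<^esub> k) ` ?U))" by (simp only: image_image)
  also have "\<dots> = pair_height p u" by (simp only: U pair_height_units[OF p0])
  finally show ?thesis ..
qed

lemma height_proj_point:
  assumes p: "Factorial_Ring.prime p" and u: "(a1, a2) \<in> nonzero_pairs p"
  shows "proj_point p a1 a2 \<in> proj_line p"
    and "height p (proj_point p a1 a2) = pair_height p (a1, a2)"
proof -
  show "proj_point p a1 a2 \<in> proj_line p"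
    using u by (auto simp: proj_point_def proj_line_def intro: quotientI)
  have "(a1, a2) \<in> proj_point p a1 a2"
    using equiv_class_self[OF equiv_proj_rel[OF p] u] by (simp add: proj_point_def)
  then show "height p (proj_point p a1 a2) = pair_height p (a1, a2)"
    unfolding height_def
    by (intro the_equality) (auto simp: proj_point_def dest: pair_height_cong[OF p])
qed

end

(* Let p = 2m + 1 and a = b mod p with 0 <= b < p. If x + y b is divisible by p, then so is
   x k + y (k b mod p), which for x, k > 0 is therefore at least p. The choices (x, y) = (1, 2),
   (2, 1), (1, 1) give the lower bounds for b = m, p - 2, p - 1, respectively. For b < m take
   k = 1. In the remaining cases put c = p - b, so that 3 <= c <= m, and take k = p div c: then
   k + (k b mod p) = p div c + p mod c, which is at most m. *)
theory Submission
  imports Defs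
begin

text \<open>Evaluating at the representative (1, b) turns the height into a minimum over natural
  numbers, where the rest of the argument takes place.\<close>

lemma height_proj_point_one:
  assumes p: "Factorial_Ring.prime p"
  shows "height p (proj_point p \<one>\<^bsub>Fp p\<^esub> (residue_class p (int b))) =
    Min ((\<lambda>k. k + k * b mod p) ` {1..p - 1})"
proof -
  have "p > 1" using p by (rule prime_gt_1_nat)
  then have "(\<one>\<^bsub>Fp p\<^esub>, residue_class p (int b)) \<in> nonzero_pairs p"
    by (auto simp: nonzero_pairs_def carrier_Fp one_Fp zero_Fp ZMod_eq_mod)
  then have "height p (proj_point p \<one>\<^bsub>Fp p\<^esub> (residue_class p (int b))) =
      pair_height p (\<one>\<^bsub>Fp p\<^esub>, residue_class p (int b))"
    by (rule height_proj_point(2)[OF p])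
  also have "\<dots> = Min ((\<lambda>k. k + k * b mod p) ` {1..p - 1})"
    unfolding pair_height_def
  proof (intro arg_cong[where f = Min] image_cong refl)
    fix k assume k: "k \<in> {1..p - 1}"
    have "nat (int k * int b mod int p) = k * b mod p"
      by (metis nat_int of_nat_mod of_nat_mult)
    moreover have "nat (int k mod int p) = k"
      using k \<open>p > 1\<close> by auto
    ultimately show "least_residue (residue_class p (int k) \<otimes>\<^bsub>Fp p\<^esub> fst (\<one>\<^bsub>Fp p\<^esub>, residue_class p (int b))) +
        least_residue (residue_class p (int k) \<otimes>\<^bsub>Fp p\<^esub> snd (\<one>\<^bsub>Fp p\<^esub>, residue_class p (int b)))
        = k + k * b mod p"
      using \<open>p > 1\<close> by (simp add: one_Fp mult_Fp least_residue_residue_class)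
  qed
  finally show ?thesis .
qed

text \<open>Modulo \<open>p\<close>, the right-hand side is congruent to (x + y b) k, so it is a
  positive multiple of \<open>p\<close>.\<close>

lemma le_combination_mod:
  fixes p x y b k :: nat
  assumes "p dvd x + y * b" "x > 0" "k > 0"
  shows "p \<le> x * k + y * (k * b mod p)"
proof (rule dvd_imp_le)
  have "(x * k + y * (k * b mod p)) mod p = (x * k + y * (k * b)) mod p"
    by (metis mod_add_right_eq mod_mult_right_eq)
  also have "x * k + y * (k * b) = (x + y * b) * k"
    by (simp add: algebra_simps)
  also have "\<dots> mod p = 0"
    using assms(1) by simp
  finally show "p dvd x * k + y * (k * b mod p)" by auto
  show "0 < x * k + y * (k * b mod p)"
    using assms by simp
qed

text \<open>Write 2m + 1 = q c + r. Doubling q + r \<le> m and substituting 2m = q c + r - 1 turns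
  the claim into r + 1 \<le> q (c - 2).\<close>

lemma div_add_mod_le:
  fixes c m :: nat
  assumes "3 \<le> c" "c \<le> m"
  shows "(2 * m + 1) div c + (2 * m + 1) mod c \<le> m"
proof -
  define q r where "q = (2 * m + 1) div c" and "r = (2 * m + 1) mod c"
  have qr: "2 * m + 1 = q * c + r" by (simp add: q_def r_def)
  have r: "r < c" using assms by (simp add: r_def)
  have "(2 * c) div c \<le> q"
    unfolding q_def using assms by (intro div_le_mono) simp
  then have q: "2 \<le> q" using assms by simp
  obtain d where d: "c = d + 2" "d \<ge> 1"
    using assms that[of "c - 2"] by simp
  have "r + 1 \<le> q * d"
  proof (cases "d = 1")
    case True
    then have "c = 3" using d by simp
    then have "2 * m + 1 = 3 * q + r" "r < 3" using qr r by simp_all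
    \<comment> \<open>The only exception would be q = r = 2, excluded since 3q + r is odd.\<close>
    then have "r + 1 \<le> q" using q by presburger
    then show ?thesis using True by simp
  next
    case False
    have "2 * d \<le> q * d" using q by simp
    \<comment> \<open>Here d \<ge> 2, so r + 1 \<le> c = d + 2 \<le> 2 d.\<close>
    moreover have "r + 1 \<le> 2 * d" using False r d by linarith
    ultimately show ?thesis by linarith
  qed
  then have "q + r \<le> m" using qr d by (simp add: algebra_simps)
  then show ?thesis by (simp add: q_def r_def)
qed

text \<open>With q = p div c, the product is congruent to -q c, hence to p - q c = p mod c, which is
  already reduced because it is less than c \<le> p.\<close>

lemma mult_diff_mod_eq_mod:
  fixes p c :: nat
  assumes "0 < c" "c \<le> p"
  shows "(p div c * (p - c)) mod p = p mod c"
proof -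
  \<comment> \<open>Positivity of the quotient lets one copy of \<open>p\<close> be split off, so
    that the subtraction of q c stays within the natural numbers.\<close>
  have "p div c > 0" using assms by (simp add: div_greater_zero_iff)
  then obtain j where j: "p div c = Suc j" by (auto simp: gr0_conv_Suc)
  have le: "p div c * c \<le> p" by simp
  have "p div c * (p - c) = p div c * p - p div c * c" by (simp add: diff_mult_distrib2)
  also have "\<dots> = (p - p div c * c) + j * p"
    using le by (simp only: j) simp
  also have "p - p div c * c = p mod c"
    by (simp add: minus_div_mult_eq_mod)
  finally show ?thesis
    using mod_less_divisor[of c p] assms by (simp del: mod_less_divisor)
qed

lemma exists_add_mult_mod_le:
  fixes b m :: nat
  assumes "b < 2 * m + 1" "b \<noteq> m" "b \<noteq> 2 * m - 1" "b \<noteq> 2 * m" "m \<ge> 1"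
  shows "\<exists>k\<in>{1..2 * m}. k + k * b mod (2 * m + 1) \<le> m"
proof (cases "b < m")
  case True
  then show ?thesis using assms by (intro bexI[of _ 1]) auto
next
  case False
  define c where "c = 2 * m + 1 - b"
  \<comment> \<open>b > m gives c \<le> m; excluding b = 2m and b = 2m - 1 rules out c = 1 and c =
    2.\<close>
  have c: "3 \<le> c" "c \<le> m" and b: "b = 2 * m + 1 - c"
    using assms False by (auto simp: c_def)
  let ?k = "(2 * m + 1) div c"
  have "?k + ?k * b mod (2 * m + 1) \<le> m"
    using div_add_mod_le[OF c] c unfolding b
    by (subst mult_diff_mod_eq_mod) auto
  moreover have "?k > 0" using c by (simp add: div_greater_zero_iff)
  ultimately show ?thesis by (intro bexI[of _ ?k]) auto
qed

theorem theorem1: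
  fixes p :: nat and a :: "int set"
  assumes "Factorial_Ring.prime p" and "odd p" and "a \<in> carrier (Fp p)"
  shows "(height p (proj_point p \<one>\<^bsub>Fp p\<^esub> a) = (p + 1) div 2 \<longleftrightarrow>
            a = residue_class p ((int p - 1) div 2) \<or> a = residue_class p (int p - 2)) \<and>
         (a \<notin> {residue_class p ((int p - 1) div 2), residue_class p (int p - 2),
               residue_class p (int p - 1)} \<longrightarrow>
            height p (proj_point p \<one>\<^bsub>Fp p\<^esub> a) \<le> (p - 1) div 2)"
proof -
  obtain m where m: "p = 2 * m + 1" using \<open>odd p\<close> by (auto elim: oddE)
  have m1: "m \<ge> 1" using prime_gt_1_nat[OF assms(1)] m by simp
  obtain n where "a = residue_class p n" using assms(3) by (auto simp: carrier_Fp)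
  moreover define b where "b = nat (n mod int p)"
  ultimately have a: "a = residue_class p (int b)" and b: "b < p"
    using m by (auto simp: ZMod_eq_mod nat_less_iff)
  define f where "f = (\<lambda>k. k + k * b mod p)"
  define h where "h = Min (f ` {1..p - 1})"
  have height: "height p (proj_point p \<one>\<^bsub>Fp p\<^esub> a) = h"
    unfolding a h_def f_def by (rule height_proj_point_one[OF assms(1)])
  have h_le: "h \<le> f k" if "k \<in> {1..p - 1}" for k
    unfolding h_def using that by (intro Min_le) auto
  have "h \<in> f ` {1..p - 1}"
    unfolding h_def using m m1 by (intro Min_in) auto
  then obtain k where k: "k \<in> {1..p - 1}" "h = k + k * b mod p"
    by (auto simp: f_def)
  have lower: "p \<le> x * k + y * (k * b mod p)" if "p dvd x + y * b" "x > 0" for x y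
    using that k by (intro le_combination_mod) auto
  have class_iff: "a = residue_class p (int j) \<longleftrightarrow> b = j" if "j < p" for j
    using that b by (auto simp: a ZMod_eq_mod zmod_int[symmetric])
  have classes: "(int p - 1) div 2 = int m" "int p - 2 = int (2 * m - 1)" "int p - 1 = int (2 * m)"
    using m m1 by (auto simp: of_nat_diff)
  have iffs: "a = residue_class p ((int p - 1) div 2) \<longleftrightarrow> b = m"
      "a = residue_class p (int p - 2) \<longleftrightarrow> b = 2 * m - 1"
      "a = residue_class p (int p - 1) \<longleftrightarrow> b = 2 * m"
    \<comment> \<open>\<open>classes(1)\<close> goes first, since \<open>classes(3)\<close> would
      rewrite the numerator of its left-hand side.\<close>
    unfolding classes(1) unfolding classes(2,3) by (rule class_iff, use m m1 in simp)+
  have "h = m + 1" if "b = m"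
  proof -
    have "h \<le> m + 1" using h_le[of 1] m m1 that by (simp add: f_def)
    \<comment> \<open>As 2 h \<ge> k + 2 (k b mod p) \<ge> 2m + 1, it follows that h \<ge> m +
      1.\<close>
    moreover have "p \<le> 1 * k + 2 * (k * b mod p)" by (rule lower) (use m that in auto)
    ultimately show ?thesis using k m by simp
  qed
  moreover have "h = m + 1" if "b = 2 * m - 1"
  proof -
    \<comment> \<open>Since b is -2 modulo \<open>p\<close>, its inverse is m; the multiplier m
      therefore attains m + 1.\<close>
    have "m * b = 1 + (m - 1) * p"
      using m1 unfolding that m by (cases m) (auto simp: algebra_simps)
    then have "m * b mod p = 1 mod p" by (simp only: mod_mult_self1)
    then have "m * b mod p = 1" using m m1 by simp
    then have "h \<le> m + 1" using h_le[of m] m m1 by (simp add: f_def)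
    moreover have "p \<le> 2 * k + 1 * (k * b mod p)" by (rule lower) (use m m1 that in auto)
    ultimately show ?thesis using k m by simp
  qed
  moreover have "h \<noteq> m + 1" if "b = 2 * m"
  proof -
    \<comment> \<open>This gives h \<ge> 2m + 1, which exceeds m + 1 because m \<ge> 1.\<close>
    have "p \<le> 1 * k + 1 * (k * b mod p)" by (rule lower) (use m that in auto)
    then show ?thesis using k m m1 by simp
  qed
  moreover have "h \<le> m" if neq: "b \<noteq> m" "b \<noteq> 2 * m - 1" "b \<noteq> 2 * m"
  proof -
    obtain j where "j \<in> {1..p - 1}" "f j \<le> m"
      using exists_add_mult_mod_le[of b m] b neq m m1 by (auto simp: f_def)
    then show ?thesis using h_le[of j] by simp
  qed
  moreover have "(p + 1) div 2 = m + 1" "(p - 1) div 2 = m" using m by auto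
  ultimately show ?thesis
    unfolding height insert_iff empty_iff iffs using m1
    \<comment> \<open>The first two cases coincide when m = 1, but both give h = m + 1.\<close>
    by (cases "b = m"; cases "b = 2 * m - 1"; cases "b = 2 * m") simp_all
qed

end
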